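(* Let $n$ be a positive integer with $\gcd(n,6)=1$. If $(1)(n-4)(n-3)(6)$, respectively $(1)(n-3)(n-2)(4)$, is a minimal zero-sum sequence over $\mathbb{Z}/n$ with all entries in $[1,n)$, then it has index $1$.
   Context: A sequence is minimal zero-sum if its terms sum to $0$ and no proper nontrivial subsequence sums to $0$. For a generator $g$ of $\mathbb{Z}/n$, writing $S=(y_1g)\cdots(y_4g)$ with $1\le y_i\le n$, the $g$-norm is $\|S\|_g=\frac{1}{n}\sum y_i$, and $\mathrm{ind}(S)=\min_g\|S\|_g$ over all generators $g$. *)

theory Defs
  imports
    Complex_Main
    "HOL-Library.Multiset"
    "HOL-Algebra.Multiplicative_Group"
    "HOL-Algebra.Elementary_Groups"
begin

text \<open>
  Sequences over a finite abelian group are unordered, with repetition allowed: they are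
  multisets of group elements, and subsequences are submultisets.  HOL-Algebra groups are
  written multiplicatively, so the additive notions read as follows: the zero element is
  \<open>\<one>\<close>, a sum is a \<open>finprod\<close>, and the multiple \<open>y g\<close> is the power \<open>g [^] y\<close>.
  The group of integers modulo \<open>n\<close> is \<open>integer_mod_group n\<close>, with carrier \<open>{0..<int n}\<close>
  (for \<open>n > 0\<close>) and addition modulo \<open>n\<close>.
\<close>

definition seq_sum :: "('a, 'b) monoid_scheme \<Rightarrow> 'a multiset \<Rightarrow> 'a" where
  "seq_sum G S = finprod G (\<lambda>x. x [^]\<^bsub>G\<^esub> count S x) (set_mset S)"

definition minimal_zero_sum :: "('a, 'b) monoid_scheme \<Rightarrow> 'a multiset \<Rightarrow> bool" where
  "minimal_zero_sum G S \<longleftrightarrow>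
     set_mset S \<subseteq> carrier G \<and> seq_sum G S = \<one>\<^bsub>G\<^esub> \<and>
     (\<forall>T. T \<subset># S \<and> T \<noteq> {#} \<longrightarrow> seq_sum G T \<noteq> \<one>\<^bsub>G\<^esub>)"

definition group_generators :: "('a, 'b) monoid_scheme \<Rightarrow> 'a set" where
  "group_generators G = {g \<in> carrier G. generate G {g} = carrier G}"

text \<open>
  The coefficient of \<open>x\<close> with respect to a generator \<open>g\<close> is normalised to the range
  \<open>{1..order G}\<close>, so the zero element has coefficient \<open>order G\<close> and not \<open>0\<close>.
\<close>

definition gen_coeff :: "('a, 'b) monoid_scheme \<Rightarrow> 'a \<Rightarrow> 'a \<Rightarrow> nat" where
  "gen_coeff G g x = (THE y. 1 \<le> y \<and> y \<le> order G \<and> x = g [^]\<^bsub>G\<^esub> y)"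

definition gen_norm :: "('a, 'b) monoid_scheme \<Rightarrow> 'a \<Rightarrow> 'a multiset \<Rightarrow> real" where
  "gen_norm G g S = (\<Sum>x\<in>#S. real (gen_coeff G g x)) / real (order G)"

definition seq_index :: "('a, 'b) monoid_scheme \<Rightarrow> 'a multiset \<Rightarrow> real" where
  "seq_index G S = Min {gen_norm G g S |g. g \<in> group_generators G}"

text \<open>The definite description and the minimum above are well defined.\<close>

lemma (in group) gen_coeff_ex1:
  assumes fin: "finite (carrier G)" and g: "g \<in> group_generators G" and x: "x \<in> carrier G"
  shows "\<exists>!y. 1 \<le> y \<and> y \<le> order G \<and> x = g [^] (y::nat)"
proof -
  from g have gc: "g \<in> carrier G" and gen: "generate G {g} = carrier G"
    by (auto simp: group_generators_def)
  have ord: "ord g = order G"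
    using generate_pow_card[OF gc] gen by (simp add: order_def)
  have "carrier G = {g [^] k |k. k \<in> (UNIV :: nat set)}"
    using generate_pow_nat[OF gc] ord_ge_1[OF fin gc] gen by simp
  also have "\<dots> = (\<lambda>y. g [^] y) ` {1 .. ord g}"
  proof (intro equalityI subsetI)
    fix z assume "z \<in> {g [^] k |k. k \<in> (UNIV :: nat set)}"
    then have "z \<in> {g [^] k |k. k \<in> {0 .. ord g - 1}}"
      by (simp only: ord_elems[OF fin gc])
    then obtain k where k: "z = g [^] k" "k \<le> ord g - 1" by auto
    show "z \<in> (\<lambda>y. g [^] y) ` {1 .. ord g}"
    proof (cases "k = 0")
      case True
      then have "z = g [^] ord g" using k gc by simp
      then show ?thesis using ord_ge_1[OF fin gc] by (intro image_eqI[of _ _ "ord g"]) auto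
    next
      case False
      then show ?thesis using k by (intro image_eqI[of _ _ k]) auto
    qed
  qed blast
  finally obtain y where y: "y \<in> {1 .. ord g}" "x = g [^] y" using x by blast
  show ?thesis
  proof (rule ex1I[of _ y])
    show "1 \<le> y \<and> y \<le> order G \<and> x = g [^] y" using y unfolding ord by simp
  next
    fix z assume z: "1 \<le> z \<and> z \<le> order G \<and> x = g [^] z"
    show "z = y"
      by (rule inj_onD[OF ord_inj'[OF gc]]) (use y z in \<open>simp_all add: ord\<close>)
  qed
qed

lemma group_generators_integer_mod_group:
  assumes "n > 0"
  shows "finite (group_generators (integer_mod_group n))"
    and "group_generators (integer_mod_group n) \<noteq> {}"
proof -
  let ?G = "integer_mod_group n"
  interpret group ?G by simp
  have "group_generators ?G \<subseteq> carrier ?G"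
    unfolding group_generators_def by blast
  then show "finite (group_generators ?G)"
    by (rule finite_subset) (use assms in \<open>simp add: carrier_integer_mod_group finite_atLeastLessThan_int\<close>)
  have c: "1 mod int n \<in> carrier ?G" using assms by (simp add: carrier_integer_mod_group)
  have "carrier ?G \<subseteq> generate ?G {1 mod int n}"
  proof
    fix x assume x: "x \<in> carrier ?G"
    have "(1 mod int n) [^]\<^bsub>?G\<^esub> x = (x * (1 mod int n)) mod int n"
      by (rule int_pow_integer_mod_group)
    also have "\<dots> = x mod int n" by (simp only: mod_mult_right_eq mult_1_right)
    also have "\<dots> = x"
      using x assms by (simp only: carrier_integer_mod_group) simp
    finally show "x \<in> generate ?G {1 mod int n}"
      unfolding generate_pow[OF c] by (intro CollectI exI[of _ x] conjI UNIV_I) (rule sym)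
  qed
  moreover have "generate ?G {1 mod int n} \<subseteq> carrier ?G"
    using c by (intro generate_incl) blast
  ultimately have "1 mod int n \<in> group_generators ?G"
    using c unfolding group_generators_def by blast
  then show "group_generators ?G \<noteq> {}" by blast
qed

end

theory Submission
  imports Defs "HOL-Number_Theory.Cong"
begin

text \<open>
  Multiplying a sequence by a unit \<open>m\<close> does not change its index.  Looking at the fractional
  parts of \<open>m / n\<close>, the multiple by \<open>m\<close> of the sequence \<open>1, -4, -3, 6\<close> has residues
  \<open>m, n - 4m, n - 3m, 6m - n\<close>, with sum \<open>n\<close>, as soon as \<open>n/6 < m < n/4\<close>; likewise
  \<open>1, -3, -2, 4\<close> becomes \<open>m, n - 3m, n - 2m, 4m - n\<close> as soon as \<open>n/4 < m < n/3\<close>.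
  As \<open>n\<close> is coprime to 6, it suffices to find in these intervals an \<open>m\<close> whose only
  prime factors are 2 and 3.  Such an \<open>m\<close> is missing only for a few small \<open>n\<close>, where either another
  unit works or \<open>1\<close> and \<open>n - 1\<close> both occur in the sequence, which is then not minimal.
\<close>

section \<open>Norms in the group of integers modulo n\<close>

lemma nat_pow_integer_mod_group:
  "x [^]\<^bsub>integer_mod_group n\<^esub> (k::nat) = (int k * x) mod int n"
  using int_pow_integer_mod_group[of n x "int k"] by (simp add: int_pow_int)

lemma group_generators_integer_mod_groupI:
  assumes "n > 0" and "0 \<le> g" "g < int n" and "[m * g = 1] (mod int n)"
  shows "g \<in> group_generators (integer_mod_group n)"
proof -
  let ?G = "integer_mod_group n"
  interpret group ?G by simp
  have c: "g \<in> carrier ?G" using assms by (simp add: carrier_integer_mod_group)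
  have "carrier ?G \<subseteq> generate ?G {g}"
  proof
    fix x assume "x \<in> carrier ?G"
    then have x: "x = x mod int n" using assms(1) by (simp add: carrier_integer_mod_group)
    have "[x * (m * g) = x * 1] (mod int n)"
      using assms(4) by (rule cong_scalar_left)
    then have "x = g [^]\<^bsub>?G\<^esub> (x * m)"
      using x by (simp add: int_pow_integer_mod_group cong_def mult.assoc)
    then show "x \<in> generate ?G {g}"
      unfolding generate_pow[OF c] by blast
  qed
  moreover have "generate ?G {g} \<subseteq> carrier ?G"
    using c by (intro generate_incl) blast
  ultimately show ?thesis using c by (auto simp: group_generators_def)
qed

lemma coprime_group_generators_integer_mod_group:
  assumes "n > 0" and "g \<in> group_generators (integer_mod_group n)"
  shows "coprime g (int n)"
proof -
  let ?G = "integer_mod_group n"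
  interpret group ?G by simp
  have c: "g \<in> carrier ?G" and gen: "generate ?G {g} = carrier ?G"
    using assms(2) by (auto simp: group_generators_def)
  \<comment> \<open>Writing \<open>1 mod int n\<close> instead of \<open>1\<close> also covers the
    trivial group \<open>n = 1\<close>. Being a multiple of \<open>g\<close>, it makes
    \<open>g\<close> invertible modulo \<open>n\<close>.\<close>
  have "1 mod int n \<in> generate ?G {g}"
    using gen assms(1) by (simp add: carrier_integer_mod_group)
  then obtain k :: int where "1 mod int n = g [^]\<^bsub>?G\<^esub> k"
    unfolding generate_pow[OF c] by blast
  then have "[g * k = 1] (mod int n)"
    by (simp add: int_pow_integer_mod_group cong_def mult.commute)
  then show ?thesis using coprime_iff_invertible_int by blast
qed

lemma order_integer_mod_group:
  "n > 0 \<Longrightarrow> order (integer_mod_group n) = n"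
  by (simp add: order_def carrier_integer_mod_group)

text \<open>Turns the definite description into congruences; the third fact identifies a coefficient
  from any candidate in \<open>{1..n}\<close>.\<close>

lemma gen_coeff_integer_mod_group:
  assumes "n > 0" and "g \<in> group_generators (integer_mod_group n)" and "0 \<le> x" "x < int n"
  shows "1 \<le> gen_coeff (integer_mod_group n) g x"
    and "[int (gen_coeff (integer_mod_group n) g x) * g = x] (mod int n)"
    and "\<lbrakk>1 \<le> y; y \<le> n; [int y * g = x] (mod int n)\<rbrakk> \<Longrightarrow> gen_coeff (integer_mod_group n) g x = y"
proof -
  let ?G = "integer_mod_group n"
  interpret group ?G by simp
  have fin: "finite (carrier ?G)" and x: "x \<in> carrier ?G"
    using assms by (simp_all add: carrier_integer_mod_group)
  note ex1 = gen_coeff_ex1[OF fin assms(2) x]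
  note coeff = theI'[OF ex1, folded gen_coeff_def]
  have xmod: "x mod int n = x" using assms by simp
  show "1 \<le> gen_coeff ?G g x" using coeff by simp
  show "[int (gen_coeff ?G g x) * g = x] (mod int n)"
    using coeff xmod by (metis cong_def nat_pow_integer_mod_group)
  show "gen_coeff ?G g x = y" if "1 \<le> y" "y \<le> n" "[int y * g = x] (mod int n)"
    unfolding gen_coeff_def
    by (rule the1_equality[OF ex1])
       (use that assms xmod in \<open>simp add: order_integer_mod_group nat_pow_integer_mod_group cong_def\<close>)
qed

section \<open>Index one as an attained lower bound\<close>

text \<open>The coefficient sum times \<open>g\<close> is congruent to the sum of \<open>S\<close>,
  hence divisible by \<open>n\<close>; since \<open>g\<close> is coprime to \<open>n\<close>, the
  coefficient sum is itself a multiple of \<open>n\<close>, and it is positive.\<close>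

lemma gen_norm_integer_mod_group_ge_1:
  assumes "n > 0" and g: "g \<in> group_generators (integer_mod_group n)"
    and S: "set_mset S \<subseteq> {0..<int n}" "S \<noteq> {#}" and dvd: "int n dvd \<Sum>\<^sub># S"
  shows "gen_norm (integer_mod_group n) g S \<ge> 1"
proof -
  let ?c = "gen_coeff (integer_mod_group n) g"
  have "[int (\<Sum>x\<in>#T. ?c x) * g = \<Sum>\<^sub># T] (mod int n)" if "set_mset T \<subseteq> {0..<int n}" for T
    using that
  proof (induction T)
    case (add x T)
    then have "[int (?c x) * g = x] (mod int n)"
      using gen_coeff_integer_mod_group(2)[OF assms(1) g] by simp
    then show ?case using add by (auto simp: algebra_simps intro: cong_add)
  qed simp
  from this[OF S(1)] have "int n dvd int (\<Sum>x\<in>#S. ?c x) * g"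
    using dvd by (simp only: cong_def dvd_eq_mod_eq_0)
  then have "n dvd (\<Sum>x\<in>#S. ?c x)"
    using coprime_group_generators_integer_mod_group[OF assms(1) g]
    by (simp add: coprime_dvd_mult_left_iff coprime_commute del: of_nat_sum_mset)
  moreover have "(\<Sum>x\<in>#S. ?c x) > 0"
  proof -
    obtain x where x: "x \<in># S" using S(2) by blast
    then have "?c x \<ge> 1" using gen_coeff_integer_mod_group(1)[OF assms(1) g] S(1) by auto
    then show ?thesis using x by (auto dest!: multi_member_split)
  qed
  ultimately have "n \<le> (\<Sum>x\<in>#S. ?c x)" by (rule dvd_imp_le)
  then have "real n \<le> real (\<Sum>x\<in>#S. ?c x)" by (simp only: of_nat_le_iff)
  then show ?thesis
    using assms(1) unfolding gen_norm_def order_integer_mod_group[OF assms(1)]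
    by (simp add: le_divide_eq of_nat_sum_mset image_mset.compositionality comp_def)
qed

lemma seq_index_integer_mod_group_eq_1:
  assumes "n > 0" and g: "g \<in> group_generators (integer_mod_group n)"
    and S: "set_mset S \<subseteq> {0..<int n}" "S \<noteq> {#}" "int n dvd \<Sum>\<^sub># S"
    and norm: "gen_norm (integer_mod_group n) g S = 1"
  shows "seq_index (integer_mod_group n) S = 1"
  unfolding seq_index_def
proof (rule Min_eqI)
  show "finite {gen_norm (integer_mod_group n) g S |g. g \<in> group_generators (integer_mod_group n)}"
    using group_generators_integer_mod_group(1)[OF assms(1)] by simp
  show "1 \<in> {gen_norm (integer_mod_group n) g S |g. g \<in> group_generators (integer_mod_group n)}"
    using g norm by force
qed (use gen_norm_integer_mod_group_ge_1[OF assms(1) _ S] in auto)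

text \<open>With respect to the inverse of \<open>m\<close>, each term \<open>x\<close> has as
  coefficient the residue of \<open>m * x\<close>. The hypothesis on residues thus gives norm 1,
  which no generator can undercut.\<close>

lemma seq_index_integer_mod_group_4:
  assumes "n > 0" and "coprime m (int n)"
    and range: "{a, b, c, d} \<subseteq> {1..<int n}" and "int n dvd a + b + c + d"
    and sum: "m * a mod int n + m * b mod int n + m * c mod int n + m * d mod int n = int n"
  shows "seq_index (integer_mod_group n) {#a, b, c, d#} = 1"
proof -
  obtain g' where "[m * g' = 1] (mod int n)"
    using assms(2) coprime_iff_invertible_int by blast
  then have inv: "[m * (g' mod int n) = 1] (mod int n)"
    by (simp add: cong_def mod_mult_right_eq)
  define g where "g = g' mod int n"
  have g: "g \<in> group_generators (integer_mod_group n)"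
    by (rule group_generators_integer_mod_groupI[where m = m])
       (use inv assms(1) in \<open>simp_all add: g_def\<close>)
  have coeff: "gen_coeff (integer_mod_group n) g x = nat (m * x mod int n)"
    if x: "x \<in> {a, b, c, d}" for x
  proof (rule gen_coeff_integer_mod_group(3)[OF assms(1) g])
    have "x \<in> {1..<int n}" using range x by blast
    then show "0 \<le> x" "x < int n" by auto
    \<comment> \<open>A zero residue has to be excluded, because the zero element has coefficient
      \<open>n\<close> and not 0.\<close>
    have "\<not> int n dvd x"
      using \<open>x \<in> {1..<int n}\<close> zdvd_not_zless[of x "int n"] by auto
    then have "\<not> int n dvd m * x"
      using assms(2) coprime_dvd_mult_right_iff[of "int n" m x] by (simp add: coprime_commute)
    then have "m * x mod int n \<noteq> 0" by (simp add: dvd_eq_mod_eq_0)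
    moreover have "0 \<le> m * x mod int n" using assms(1) by simp
    ultimately show "1 \<le> nat (m * x mod int n)" by linarith
    have "m * x mod int n < int n" using assms(1) by simp
    then show "nat (m * x mod int n) \<le> n" by linarith
    have "[int (nat (m * x mod int n)) * g = m * x * g] (mod int n)"
      using assms(1) by (intro cong_scalar_right) simp
    also have "m * x * g = x * (m * g)" by simp
    also have "[x * (m * g) = x * 1] (mod int n)"
      using inv unfolding g_def by (rule cong_scalar_left)
    finally show "[int (nat (m * x mod int n)) * g = x] (mod int n)" by simp
  qed
  have "gen_norm (integer_mod_group n) g {#a, b, c, d#} = 1"
    using assms(1) sum by (simp add: gen_norm_def coeff order_integer_mod_group flip: of_int_add)
  then show ?thesis
    by (intro seq_index_integer_mod_group_eq_1[OF assms(1) g]) (use assms(3,4) in \<open>auto simp: add_ac\<close>)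
qed

section \<open>Zero-sum pairs as obstructions to minimality\<close>

lemma (in comm_monoid) seq_sum_pair:
  assumes "a \<in> carrier G" "b \<in> carrier G" "a \<noteq> b"
  shows "seq_sum G {#a, b#} = a \<otimes> b"
  using assms by (simp add: seq_sum_def finprod_insert)

lemma not_minimal_zero_sum_integer_mod_group:
  assumes "{#a, b#} \<subset># S" and "a \<noteq> b" and "a + b = int n"
  shows "\<not> minimal_zero_sum (integer_mod_group n) S"
proof
  let ?G = "integer_mod_group n"
  interpret comm_group ?G by simp
  assume min: "minimal_zero_sum ?G S"
  have "{a, b} \<subseteq> set_mset S" using assms(1) by (auto dest!: subset_mset.less_imp_le dest: mset_subset_eqD)
  then have ab: "a \<in> carrier ?G" "b \<in> carrier ?G"
    using min by (auto simp: minimal_zero_sum_def)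
  have "seq_sum ?G {#a, b#} = a \<otimes>\<^bsub>?G\<^esub> b"
    using ab assms(2) by (rule seq_sum_pair)
  also have "\<dots> = \<one>\<^bsub>?G\<^esub>" by (simp add: mult_integer_mod_group assms(3))
  finally show False using min assms(1) by (auto simp: minimal_zero_sum_def)
qed

section \<open>Units in short intervals\<close>

text \<open>Take \<open>k\<close> as the integer part of the binary logarithm of
  \<open>n div c\<close>. This reduces the search for units to a single octave of
  \<open>n\<close>.\<close>

lemma dyadic_scale:
  fixes c n :: nat
  assumes "0 < c" and "c \<le> n"
  obtains k where "c * 2 ^ k \<le> n" and "n < 2 * (c * 2 ^ k)"
proof -
  have "1 \<le> n div c" using assms by (simp add: Suc_le_eq div_greater_zero_iff)
  then obtain k where "2 ^ k \<le> n div c" "n div c < 2 ^ (k + 1)"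
    using ex_power_ivl1[of 2 "n div c"] by blast
  then have "c * 2 ^ k \<le> n" "n < 2 * (c * 2 ^ k)"
    using assms(1) by (simp_all add: less_eq_div_iff_mult_less_eq div_less_iff_less_mult mult_ac)
  then show ?thesis by (rule that)
qed

text \<open>A given \<open>m\<close> serves all \<open>n\<close> strictly between
  \<open>4 * m\<close> and \<open>6 * m\<close>. Up to the factor \<open>2 ^ k\<close>, the choices
  2 and 3 serve (8, 12) and (12, 18), which cover the octave from 8 to 16 except for 8 and 12; these
  are excluded by parity.\<close>

lemma unit_between_sixth_and_quarter:
  fixes n :: nat
  assumes "coprime n 6" and "n \<ge> 8"
  obtains m where "coprime m n" and "4 * m < n" and "n < 6 * m"
proof -
  have co: "coprime 2 n" "coprime 3 n"
    using assms(1) coprime_mult_right_iff[of n 2 3] by (simp_all add: coprime_commute)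
  then have "odd n" by simp
  obtain k where k: "8 * 2 ^ k \<le> n" "n < 2 * (8 * 2 ^ k)"
    using dyadic_scale[of 8 n] assms(2) by auto
  have ne: "n \<noteq> 8 * 2 ^ k" "n \<noteq> 12 * 2 ^ k" using \<open>odd n\<close> by auto
  show ?thesis
  proof (cases "n < 12 * 2 ^ k")
    case True
    then show ?thesis using that[of "2 * 2 ^ k"] k ne co by simp
  next
    case False
    then show ?thesis using that[of "3 * 2 ^ k"] k ne co by simp
  qed
qed

text \<open>Here \<open>m\<close> serves the \<open>n\<close> strictly between \<open>3 * m\<close>
  and \<open>4 * m\<close>, a narrower window, so an octave takes three choices and small
  \<open>n\<close> are treated one by one.\<close>

lemma unit_between_quarter_and_third:
  fixes n :: nat
  assumes "coprime n 6" and "n \<ge> 7"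
  obtains m where "coprime m n" and "3 * m < n" and "n < 4 * m"
proof -
  have co: "coprime 2 n" "coprime 3 n"
    using assms(1) coprime_mult_right_iff[of n 2 3] by (simp_all add: coprime_commute)
  then have "odd n" by simp
  have "\<not> 3 dvd n" using co(2) coprime_absorb_left[of 3 n] by auto
  have co': "coprime 4 n" "coprime 6 n" "coprime 8 n" "coprime 9 n" "coprime 12 n" "coprime 16 n"
    using co coprime_mult_left_iff[of 2 2 n] coprime_mult_left_iff[of 2 3 n]
      coprime_mult_left_iff[of 2 4 n] coprime_mult_left_iff[of 3 3 n]
      coprime_mult_left_iff[of 3 4 n] coprime_mult_left_iff[of 4 4 n] by simp_all
  show ?thesis
  proof (cases "n < 32")
    case True
    then have "n = 7 \<or> n = 11 \<or> 12 < n \<and> n < 16 \<or> n = 17 \<or> 18 < n \<and> n < 24 \<or> 24 < n"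
      using \<open>odd n\<close> \<open>\<not> 3 dvd n\<close> assms(2) by presburger
    then consider "n = 7" | "n = 11" | "12 < n" "n < 16" | "n = 17" | "18 < n" "n < 24" | "24 < n"
      by blast
    then show ?thesis
    proof cases
      case 1
      then show ?thesis using that[of 2] co by simp
    next
      case 2
      then show ?thesis using that[of 3] co by simp
    next
      case 3
      then show ?thesis using that[of 4] co' by simp
    next
      case 4
      \<comment> \<open>The only integer between 17/4 and 17/3 is 5, so no product of powers of 2
        and 3 is available here.\<close>
      have "coprime 5 (17 :: nat)" by (simp add: coprime_iff_gcd_eq_1 gcd_non_0_nat)
      with 4 show ?thesis using that[of 5] by simp
    next
      case 5
      then show ?thesis using that[of 6] co' by simp
    next
      case 6
      then show ?thesis using that[of 8] co' True by simp
    qed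
  next
    case False
    then obtain k where k: "32 * 2 ^ k \<le> n" "n < 2 * (32 * 2 ^ k)"
      using dyadic_scale[of 32 n] by auto
    \<comment> \<open>Up to the factor \<open>2 ^ k\<close>, the choices 9, 12 and 16 serve (27,
      36), (36, 48) and (48, 64). The common endpoints are even, so \<open>n\<close> avoids
      them.\<close>
    have ne: "n \<noteq> 36 * 2 ^ k" "n \<noteq> 48 * 2 ^ k" using \<open>odd n\<close> by auto
    consider "n < 36 * 2 ^ k" | "36 * 2 ^ k < n" "n < 48 * 2 ^ k" | "48 * 2 ^ k < n"
      using ne by linarith
    then show ?thesis
    proof cases
      case 1
      then show ?thesis using that[of "9 * 2 ^ k"] k co co' by simp
    next
      case 2
      then show ?thesis using that[of "12 * 2 ^ k"] co co' by simp
    next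
      case 3
      then show ?thesis using that[of "16 * 2 ^ k"] k co co' by simp
    qed
  qed
qed

section \<open>The two families of sequences\<close>

theorem theorem2:
  fixes n :: nat
  assumes "n > 0" and "gcd n 6 = 1"
  shows "({1, int n - 4, int n - 3, 6} \<subseteq> {1..<int n} \<and>
            minimal_zero_sum (integer_mod_group n) {#1, int n - 4, int n - 3, 6#} \<longrightarrow>
            seq_index (integer_mod_group n) {#1, int n - 4, int n - 3, 6#} = 1) \<and>
         ({1, int n - 3, int n - 2, 4} \<subseteq> {1..<int n} \<and>
            minimal_zero_sum (integer_mod_group n) {#1, int n - 3, int n - 2, 4#} \<longrightarrow>
            seq_index (integer_mod_group n) {#1, int n - 3, int n - 2, 4#} = 1)"
proof (intro conjI impI; elim conjE)
  have co: "coprime n 6" using assms(2) by (simp add: coprime_iff_gcd_eq_1)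
  assume range: "{1, int n - 4, int n - 3, 6} \<subseteq> {1..<int n}"
    and min: "minimal_zero_sum (integer_mod_group n) {#1, int n - 4, int n - 3, 6#}"
  \<comment> \<open>No integer lies between 7/6 and 7/4, but for \<open>n = 7\<close> the terms 1
    and 6 already sum to zero.\<close>
  have "n \<noteq> 7"
  proof
    assume "n = 7"
    then show False
      using min not_minimal_zero_sum_integer_mod_group[of 1 6 "{#1, int n - 4, int n - 3, 6#}" n]
      by (simp add: subset_mset_def add_mset_commute)
  qed
  then have "n \<ge> 8" using range by auto
  with co obtain m where m: "coprime m n" "4 * m < n" "n < 6 * m"
    by (rule unit_between_sixth_and_quarter)
  have "int m * 1 mod int n = int m" using m by simp
  \<comment> \<open>The quotient comes from m(n - 4) = (m - 1)n + (n - 4m), where n - 4m >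
    0.\<close>
  moreover have "int m * (int n - 4) mod int n = int n - 4 * int m"
    by (rule int_mod_pos_eq[where q = "int m - 1"]) (use m in \<open>simp_all add: algebra_simps\<close>)
  moreover have "int m * (int n - 3) mod int n = int n - 3 * int m"
    by (rule int_mod_pos_eq[where q = "int m - 1"]) (use m in \<open>simp_all add: algebra_simps\<close>)
  \<comment> \<open>From n < 6m and 4m < n follows n < 6m < 2n, so the quotient is 1.\<close>
  moreover have "int m * 6 mod int n = 6 * int m - int n"
    by (rule int_mod_pos_eq[where q = "1"]) (use m in \<open>simp_all add: algebra_simps\<close>)
  ultimately show "seq_index (integer_mod_group n) {#1, int n - 4, int n - 3, 6#} = 1"
    using m(1) range assms(1) by (intro seq_index_integer_mod_group_4[where m = "int m"]) auto
next
  have co: "coprime n 6" using assms(2) by (simp add: coprime_iff_gcd_eq_1)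
  assume range: "{1, int n - 3, int n - 2, 4} \<subseteq> {1..<int n}"
    and min: "minimal_zero_sum (integer_mod_group n) {#1, int n - 3, int n - 2, 4#}"
  \<comment> \<open>Likewise no integer lies between 5/4 and 5/3, and for \<open>n = 5\<close> the
    terms 1 and 4 sum to zero.\<close>
  have "n \<noteq> 5"
  proof
    assume "n = 5"
    then show False
      using min not_minimal_zero_sum_integer_mod_group[of 1 4 "{#1, int n - 3, int n - 2, 4#}" n]
      by (simp add: subset_mset_def add_mset_commute)
  qed
  moreover have "n \<noteq> 6" using co by auto
  ultimately have "n \<ge> 7" using range by auto
  with co obtain m where m: "coprime m n" "3 * m < n" "n < 4 * m"
    by (rule unit_between_quarter_and_third)
  have "int m * 1 mod int n = int m" using m by simp
  moreover have "int m * (int n - 3) mod int n = int n - 3 * int m"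
    by (rule int_mod_pos_eq[where q = "int m - 1"]) (use m in \<open>simp_all add: algebra_simps\<close>)
  moreover have "int m * (int n - 2) mod int n = int n - 2 * int m"
    by (rule int_mod_pos_eq[where q = "int m - 1"]) (use m in \<open>simp_all add: algebra_simps\<close>)
  moreover have "int m * 4 mod int n = 4 * int m - int n"
    by (rule int_mod_pos_eq[where q = "1"]) (use m in \<open>simp_all add: algebra_simps\<close>)
  ultimately show "seq_index (integer_mod_group n) {#1, int n - 3, int n - 2, 4#} = 1"
    using m(1) range assms(1) by (intro seq_index_integer_mod_group_4[where m = "int m"]) auto
qed

end
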